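(* Let $M\in\mathbb{R}^{m\times n}$, $1\le s\le\min(m,n)$, be partitioned as $M=\begin{bmatrix}A_M & B_M \\ F_M & C_M\end{bmatrix}$ with $A_M\in\mathbb{R}^{s\times s}$ non-singular, and let $\hat M=\begin{bmatrix}A_M \\ F_M\end{bmatrix}A_M^{-1}\begin{bmatrix}A_M & B_M\end{bmatrix}$. Let $A_M=U\Lambda H^T$ be a singular value decomposition ($U,H\in\mathbb{R}^{s\times s}$ orthogonal, $\Lambda$ diagonal with positive diagonal entries). Define $$\hat U=\begin{bmatrix}U \\ F_MH\Lambda^{-1}\end{bmatrix},\quad \hat H=\begin{bmatrix}H \\ B_M^TU\Lambda^{-1}\end{bmatrix},\quad Z_U=\hat U\Lambda^{1/2},\quad Z_H=\hat H\Lambda^{1/2}.$$ Let $Z_U^TZ_U=F_U\Sigma_UF_U^T$ and $Z_H^TZ_H=F_H\Sigma_HF_H^T$ be orthogonal diagonalizations of these symmetric $s\times s$ matrices, let $D=\Sigma_U^{1/2}F_U^TF_H\Sigma_H^{1/2}$, and let $D=U_D\Lambda_DH_D^T$ be a singular value decomposition of $D$. Put $U_o=Z_UF_U\Sigma_U^{-1/2}U_D$ and $H_o=Z_HF_H\Sigma_H^{-1/2}H_D$. Then $U_o^TU_o=I$, $H_o^TH_o=I$ and $U_o\Lambda_DH_o^T=\hat M$; that is, $U_o\Lambda_DH_o^T$ is a rank-$s$ (thin) singular value decomposition of $\hat M$. Moreover, $U_o,\Lambda_D,H_o$ are computed from $A_M,B_M,F_M$ by this procedure in $O(s^2(m+n))$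 operations.
   Context: $\hat M$ is the Nyström approximation of $M$ from the sample matrix $A_M$; it equals $\begin{bmatrix}A_M & B_M \\ F_M & F_MA_M^{-1}B_M\end{bmatrix}$. Here $B_M\in\mathbb{R}^{s\times(n-s)}$, $F_M\in\mathbb{R}^{(m-s)\times s}$, $C_M\in\mathbb{R}^{(m-s)\times(n-s)}$. Operations are arithmetic operations; a singular value or eigenvalue decomposition of an $s\times s$ matrix is counted as $O(s^3)$ operations, and products of an $a\times b$ and a $b\times c$ matrix as $O(abc)$ operations. *)

theory Defs
  imports
    "Jordan_Normal_Form.Gauss_Jordan_Elimination"
    "Jordan_Normal_Form.DL_Rank"
    "HOL-Library.Monad_Syntax"
    Complex_Main
begin

text \<open>The library predicate \<^const>\<open>orthogonal_mat\<close> only asks for pairwise orthogonal columns,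
  so orthogonality in the usual (orthonormal) sense is defined here.\<close>

definition real_orthogonal :: "nat \<Rightarrow> real mat \<Rightarrow> bool" where
  "real_orthogonal n Q \<longleftrightarrow>
     Q \<in> carrier_mat n n \<and> transpose_mat Q * Q = 1\<^sub>m n \<and> Q * transpose_mat Q = 1\<^sub>m n"

text \<open>No order is imposed on the singular values or the eigenvalues.\<close>

definition is_svd :: "nat \<Rightarrow> real mat \<Rightarrow> real mat \<Rightarrow> real mat \<Rightarrow> real mat \<Rightarrow> bool" where
  "is_svd n X U L V \<longleftrightarrow>
     real_orthogonal n U \<and> real_orthogonal n V \<and>
     L \<in> carrier_mat n n \<and> diagonal_mat L \<and> (\<forall>i<n. L $$ (i,i) \<ge> 0) \<and>
     X = U * L * transpose_mat V"

definition is_orth_diag :: "nat \<Rightarrow> real mat \<Rightarrow> real mat \<Rightarrow> real mat \<Rightarrow> bool" where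
  "is_orth_diag n X Q S \<longleftrightarrow>
     real_orthogonal n Q \<and> S \<in> carrier_mat n n \<and> diagonal_mat S \<and>
     X = Q * S * transpose_mat Q"

definition is_thin_svd ::
  "nat \<Rightarrow> nat \<Rightarrow> nat \<Rightarrow> real mat \<Rightarrow> real mat \<Rightarrow> real mat \<Rightarrow> real mat \<Rightarrow> bool" where
  "is_thin_svd m n r X U L V \<longleftrightarrow>
     X \<in> carrier_mat m n \<and>
     U \<in> carrier_mat m r \<and> transpose_mat U * U = 1\<^sub>m r \<and>
     V \<in> carrier_mat n r \<and> transpose_mat V * V = 1\<^sub>m r \<and>
     L \<in> carrier_mat r r \<and> diagonal_mat L \<and> (\<forall>i<r. L $$ (i,i) > 0) \<and>
     U * L * transpose_mat V = X"

definition append_cols :: "real mat \<Rightarrow> real mat \<Rightarrow> real mat" (infixr \<open>@\<^sub>c\<close> 65) where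
  "X @\<^sub>c Y = four_block_mat X Y (0\<^sub>m 0 (dim_col X)) (0\<^sub>m 0 (dim_col Y))"

text \<open>\<open>f\<close> applied to the diagonal entries: for a diagonal matrix \<open>L\<close> with positive diagonal,
  \<open>diag_map sqrt L\<close>, \<open>diag_map inverse L\<close> and \<open>diag_map (\<lambda>x. inverse (sqrt x)) L\<close> are the powers
  of \<open>L\<close> with exponents \<open>1/2\<close>, \<open>-1\<close> and \<open>-1/2\<close>.\<close>

definition diag_map :: "(real \<Rightarrow> real) \<Rightarrow> real mat \<Rightarrow> real mat" where
  "diag_map f L =
     mat (dim_row L) (dim_col L) (\<lambda>(i,j). if i = j then f (L $$ (i,j)) else 0)"

definition nystrom :: "real mat \<Rightarrow> real mat \<Rightarrow> real mat \<Rightarrow> real mat" where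
  "nystrom A B F = (A @\<^sub>r F) * the (mat_inverse A) * (A @\<^sub>c B)"

text \<open>\<open>p x k\<close> means that some run of the computation \<open>p\<close> returns \<open>x\<close> after \<open>k\<close> arithmetic
  operations. Computations are nondeterministic because singular value decompositions and
  orthogonal diagonalizations are not unique.
  Products and decompositions are charged according to cost functions of the dimensions,
  which are left as parameters; an operation on a diagonal matrix is charged one scalar
  operation per diagonal entry.\<close>

type_synonym 'a costed = "'a \<Rightarrow> nat \<Rightarrow> bool"

definition costed_return :: "'a \<Rightarrow> 'a costed" where
  "costed_return x = (\<lambda>y k. y = x \<and> k = 0)"

definition costed_bind :: "'a costed \<Rightarrow> ('a \<Rightarrow> 'b costed) \<Rightarrow> 'b costed" where
  "costed_bind p f = (\<lambda>y k. \<exists>x i j. p x i \<and> f x y j \<and> k = i + j)"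

adhoc_overloading
  bind \<rightleftharpoons> costed_bind

definition mul_op :: "(nat \<Rightarrow> nat \<Rightarrow> nat \<Rightarrow> nat) \<Rightarrow> real mat \<Rightarrow> real mat \<Rightarrow> real mat costed" where
  "mul_op mul_cost X Y = (\<lambda>Z k.
     dim_col X = dim_row Y \<and> Z = X * Y \<and> k = mul_cost (dim_row X) (dim_col X) (dim_col Y))"

definition svd_op :: "(nat \<Rightarrow> nat) \<Rightarrow> real mat \<Rightarrow> (real mat \<times> real mat \<times> real mat) costed" where
  "svd_op svd_cost X = (\<lambda>(U, L, V) k.
     is_svd (dim_row X) X U L V \<and> k = svd_cost (dim_row X))"

definition eig_op :: "(nat \<Rightarrow> nat) \<Rightarrow> real mat \<Rightarrow> (real mat \<times> real mat) costed" where
  "eig_op eig_cost X = (\<lambda>(Q, S) k.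
     is_orth_diag (dim_row X) X Q S \<and> k = eig_cost (dim_row X))"

definition diag_sqrt_op :: "real mat \<Rightarrow> real mat costed" where
  "diag_sqrt_op L = (\<lambda>R k. R = diag_map sqrt L \<and> k = dim_row L)"

definition diag_inv_op :: "real mat \<Rightarrow> real mat costed" where
  "diag_inv_op L = (\<lambda>R k. R = diag_map inverse L \<and> k = dim_row L)"

text \<open>Transposing and stacking blocks involve no arithmetic operation.\<close>

definition nystrom_svd ::
  "(nat \<Rightarrow> nat) \<Rightarrow> (nat \<Rightarrow> nat) \<Rightarrow> (nat \<Rightarrow> nat \<Rightarrow> nat \<Rightarrow> nat) \<Rightarrow>
   real mat \<Rightarrow> real mat \<Rightarrow> real mat \<Rightarrow> (real mat \<times> real mat \<times> real mat) costed" where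
  "nystrom_svd svd_cost eig_cost mul_cost A B F = do {
     (U, L, H) \<leftarrow> svd_op svd_cost A;
     Linv \<leftarrow> diag_inv_op L;
     Lsqrt \<leftarrow> diag_sqrt_op L;
     FmH \<leftarrow> mul_op mul_cost F H;
     FHL \<leftarrow> mul_op mul_cost FmH Linv;
     BU \<leftarrow> mul_op mul_cost (transpose_mat B) U;
     BUL \<leftarrow> mul_op mul_cost BU Linv;
     ZU \<leftarrow> mul_op mul_cost (U @\<^sub>r FHL) Lsqrt;
     ZH \<leftarrow> mul_op mul_cost (H @\<^sub>r BUL) Lsqrt;
     GU \<leftarrow> mul_op mul_cost (transpose_mat ZU) ZU;
     GH \<leftarrow> mul_op mul_cost (transpose_mat ZH) ZH;
     (FU, SU) \<leftarrow> eig_op eig_cost GU;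
     (FH, SH) \<leftarrow> eig_op eig_cost GH;
     SUsqrt \<leftarrow> diag_sqrt_op SU;
     SHsqrt \<leftarrow> diag_sqrt_op SH;
     SUinvsqrt \<leftarrow> diag_inv_op SUsqrt;
     SHinvsqrt \<leftarrow> diag_inv_op SHsqrt;
     D1 \<leftarrow> mul_op mul_cost SUsqrt (transpose_mat FU);
     D2 \<leftarrow> mul_op mul_cost D1 FH;
     D \<leftarrow> mul_op mul_cost D2 SHsqrt;
     (UD, LD, HD) \<leftarrow> svd_op svd_cost D;
     U1 \<leftarrow> mul_op mul_cost ZU FU;
     U2 \<leftarrow> mul_op mul_cost U1 SUinvsqrt;
     Uo \<leftarrow> mul_op mul_cost U2 UD;
     H1 \<leftarrow> mul_op mul_cost ZH FH;
     H2 \<leftarrow> mul_op mul_cost H1 SHinvsqrt;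
     Ho \<leftarrow> mul_op mul_cost H2 HD;
     costed_return (Uo, LD, Ho)
   }"

end

theory Submission
  imports Defs
begin

text \<open>
  From \<open>A H = U \<Lambda>\<close> one gets \<open>Z\<^sub>U = [A; F] H \<Lambda>\<^sup>-\<^sup>1\<^sup>/\<^sup>2\<close> and, applying this to the transposed data,
  \<open>Z\<^sub>H = [A, B]\<^sup>T U \<Lambda>\<^sup>-\<^sup>1\<^sup>/\<^sup>2\<close>. Since \<open>A\<^sup>-\<^sup>1 = H \<Lambda>\<^sup>-\<^sup>1 U\<^sup>T\<close>, the Nystrom approximation is \<open>Z\<^sub>U Z\<^sub>H\<^sup>T\<close>.
  The top blocks of \<open>Z\<^sub>U\<close> and \<open>Z\<^sub>H\<close> are invertible, so both have left inverses; hence their Gram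
  matrices have positive eigenvalues, \<open>Z\<^sub>U F\<^sub>U \<Sigma>\<^sub>U\<^sup>-\<^sup>1\<^sup>/\<^sup>2\<close> and \<open>Z\<^sub>H F\<^sub>H \<Sigma>\<^sub>H\<^sup>-\<^sup>1\<^sup>/\<^sup>2\<close> have orthonormal columns,
  and \<open>D\<close> is the invertible matrix of \<open>Z\<^sub>U Z\<^sub>H\<^sup>T\<close> with respect to these columns.
  Every product in the procedure has two of its three dimensions equal to \<open>s\<close> and the third
  at most \<open>max m n\<close>, which bounds its cost by a multiple of \<open>s\<^sup>2 (m + n)\<close>.
\<close>

section \<open>Matrix algebra\<close>

text \<open>The side conditions are equations between dimensions, so the simplifier can discharge
  them without guessing the carrier sizes of the intermediate products.\<close>

lemma mult_mat_assoc_dim: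
  fixes X Y Z :: "'a::semiring_0 mat"
  assumes "dim_col X = dim_row Y" "dim_col Y = dim_row Z"
  shows "X * Y * Z = X * (Y * Z)"
  using assms by (intro assoc_mult_mat) (auto intro: carrier_matI)

lemma transpose_mult_dim:
  fixes X Y :: "'a::comm_semiring_0 mat"
  assumes "dim_col X = dim_row Y"
  shows "transpose_mat (X * Y) = transpose_mat Y * transpose_mat X"
  using assms by (intro transpose_mult) (auto intro: carrier_matI)

text \<open>Once products are nested to the right, a pair of mutually inverse neighbours shows up as
  \<open>X * (Y * W)\<close> and never as \<open>X * Y\<close>. This is the rewrite rule for that
  shape.\<close>

lemma inverse_mult_cancel_left:
  fixes X Y W :: "'a::semiring_1 mat"
  assumes "X * Y = 1\<^sub>m n" "dim_col X = dim_row Y" "dim_row W = n"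
  shows "X * (Y * W) = W"
proof -
  have "dim_col Y = n"
    using assms(1) by (metis index_mult_mat(3) index_one_mat(3))
  then have "X * (Y * W) = X * Y * W"
    using assms by (subst mult_mat_assoc_dim) auto
  then show ?thesis
    using assms by auto
qed

section \<open>Stacked blocks\<close>

lemma append_rows_dims [simp]:
  "dim_row (X @\<^sub>r Y) = dim_row X + dim_row Y"
  "dim_col (X @\<^sub>r Y) = dim_col X"
  by (simp_all add: append_rows_def)

lemma append_cols_dims [simp]:
  "dim_row (X @\<^sub>c Y) = dim_row X"
  "dim_col (X @\<^sub>c Y) = dim_col X + dim_col Y"
  by (simp_all add: append_cols_def)

lemma append_rows_mult:
  fixes X :: "'a::semiring_0 mat"
  assumes "X \<in> carrier_mat k s" "Y \<in> carrier_mat l s" "Z \<in> carrier_mat s t"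
  shows "(X @\<^sub>r Y) * Z = X * Z @\<^sub>r Y * Z"
  using assms
  by (intro eq_matI)
    (auto simp: append_rows_def scalar_prod_def intro!: sum.cong)

lemma append_cols_mult_append_rows:
  assumes "X \<in> carrier_mat k s" "Y \<in> carrier_mat k t" "V \<in> carrier_mat s l" "W \<in> carrier_mat t l"
  shows "(X @\<^sub>c Y) * (V @\<^sub>r W) = X * V + Y * W"
proof -
  \<comment> \<open>Blocks with no rows or no columns make both factors four-block matrices, so the
    block product rule applies.\<close>
  have "(X @\<^sub>c Y) * (V @\<^sub>r W) =
      four_block_mat X Y (0\<^sub>m 0 s) (0\<^sub>m 0 t) * four_block_mat V (0\<^sub>m s 0) W (0\<^sub>m t 0)"
    using assms by (simp add: append_cols_def append_rows_def)
  also have "\<dots> = four_block_mat (X * V + Y * W) (X * 0\<^sub>m s 0 + Y * 0\<^sub>m t 0)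
      (0\<^sub>m 0 s * V + 0\<^sub>m 0 t * W) (0\<^sub>m 0 s * 0\<^sub>m s 0 + 0\<^sub>m 0 t * 0\<^sub>m t 0)"
    using assms by (intro mult_four_block_mat) auto
  also have "\<dots> = X * V + Y * W"
    using assms by (intro eq_matI) auto
  finally show ?thesis .
qed

lemma transpose_append_rows:
  assumes "X \<in> carrier_mat k s" "Y \<in> carrier_mat l s"
  shows "transpose_mat (X @\<^sub>r Y) = transpose_mat X @\<^sub>c transpose_mat Y"
  using assms by (intro eq_matI) (auto simp: append_rows_def append_cols_def)

text \<open>Padding \<open>G\<close> with zero columns makes the product ignore the lower block
  \<open>Y\<close>.\<close>

lemma append_rows_left_inverse:
  fixes G :: "real mat"
  assumes "G \<in> carrier_mat s k" "X \<in> carrier_mat k s" "Y \<in> carrier_mat l s" "G * X = 1\<^sub>m s"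
  shows "\<exists>G' \<in> carrier_mat s (k + l). G' * (X @\<^sub>r Y) = 1\<^sub>m s"
proof (rule bexI)
  show "(G @\<^sub>c 0\<^sub>m s l) * (X @\<^sub>r Y) = 1\<^sub>m s"
    using assms by (subst append_cols_mult_append_rows[where k = s and s = k and t = l and l = s]) auto
  show "G @\<^sub>c 0\<^sub>m s l \<in> carrier_mat s (k + l)"
    using assms by (auto intro: carrier_matI)
qed

section \<open>Functions of diagonal matrices\<close>

lemma diag_map_dims [simp]:
  "dim_row (diag_map f L) = dim_row L" "dim_col (diag_map f L) = dim_col L"
  by (simp_all add: diag_map_def)

lemma diag_map_carrier [simp, intro]:
  "L \<in> carrier_mat m n \<Longrightarrow> diag_map f L \<in> carrier_mat m n"
  by (auto intro: carrier_matI)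

lemma transpose_diag_map:
  "L \<in> carrier_mat n n \<Longrightarrow> transpose_mat (diag_map f L) = diag_map f L"
  by (rule eq_matI) (auto simp: diag_map_def)

text \<open>Both factors vanish off the diagonal, whatever \<open>L\<close> is, so only the summand
  with \<open>k = i\<close> can survive in entry \<open>(i, j)\<close>.\<close>

lemma diag_map_mult:
  assumes "L \<in> carrier_mat n n"
  shows "diag_map f L * diag_map g L = diag_map (\<lambda>x. f x * g x) L"
proof (rule eq_matI)
  fix i j assume ij: "i < dim_row (diag_map (\<lambda>x. f x * g x) L)" "j < dim_col (diag_map (\<lambda>x. f x * g x) L)"
  with assms have "(diag_map f L * diag_map g L) $$ (i, j) =
      (\<Sum>k = 0..<n. diag_map f L $$ (i, k) * diag_map g L $$ (k, j))"
    by (simp add: scalar_prod_def)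
  also have "\<dots> = (\<Sum>k \<in> {0..<n} \<inter> {i}. diag_map f L $$ (i, k) * diag_map g L $$ (k, j))"
    using ij assms by (intro sum.mono_neutral_right) (auto simp: diag_map_def)
  also have "\<dots> = diag_map (\<lambda>x. f x * g x) L $$ (i, j)"
    using ij assms by (auto simp: diag_map_def)
  finally show "(diag_map f L * diag_map g L) $$ (i, j) = diag_map (\<lambda>x. f x * g x) L $$ (i, j)" .
qed (use assms in auto)

lemma diag_map_diag_map: "diag_map f (diag_map g L) = diag_map (\<lambda>x. f (g x)) L"
  by (rule eq_matI) (auto simp: diag_map_def)

lemma diag_map_eq_self:
  assumes "L \<in> carrier_mat n n" "diagonal_mat L" "\<And>i. i < n \<Longrightarrow> f (L $$ (i, i)) = L $$ (i, i)"
  shows "diag_map f L = L"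
  using assms by (intro eq_matI) (auto simp: diag_map_def diagonal_mat_def)

lemma diag_map_eq_one:
  assumes "L \<in> carrier_mat n n" "\<And>i. i < n \<Longrightarrow> f (L $$ (i, i)) = 1"
  shows "diag_map f L = 1\<^sub>m n"
  using assms by (intro eq_matI) (auto simp: diag_map_def)

lemma diag_map_cong_diag:
  assumes "L \<in> carrier_mat n n" "\<And>i. i < n \<Longrightarrow> f (L $$ (i, i)) = g (L $$ (i, i))"
  shows "diag_map f L = diag_map g L"
  using assms by (intro eq_matI) (auto simp: diag_map_def)

section \<open>Powers of a diagonal matrix with positive diagonal\<close>

context
  fixes L :: "real mat" and n
  assumes L: "L \<in> carrier_mat n n" "diagonal_mat L" and pos: "\<And>i. i < n \<Longrightarrow> L $$ (i, i) > 0"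
begin

lemma diag_sqrt_mult_inv_sqrt:
  "diag_map sqrt L * diag_map (\<lambda>x. inverse (sqrt x)) L = 1\<^sub>m n"
  "diag_map (\<lambda>x. inverse (sqrt x)) L * diag_map sqrt L = 1\<^sub>m n"
  using pos
  by (auto simp: diag_map_mult[OF L(1)] less_imp_neq[THEN not_sym] intro!: diag_map_eq_one[OF L(1)])

lemma diag_mult_inverse: "L * diag_map inverse L = 1\<^sub>m n"
proof -
  \<comment> \<open>Diagonality lets \<open>L\<close> itself be written as a
    \<open>diag_map\<close>, so that \<open>diag_map_mult\<close> covers products with
    \<open>L\<close>.\<close>
  have id: "diag_map (\<lambda>x. x) L = L"
    by (rule diag_map_eq_self[OF L]) auto
  have "diag_map (\<lambda>x. x) L * diag_map inverse L = 1\<^sub>m n"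
    using pos
    by (auto simp: diag_map_mult[OF L(1)] less_imp_neq[THEN not_sym] intro!: diag_map_eq_one[OF L(1)])
  then show ?thesis
    by (simp add: id)
qed

lemma diag_inverse_mult_sqrt:
  "diag_map inverse L * diag_map sqrt L = diag_map (\<lambda>x. inverse (sqrt x)) L"
proof -
  have "inverse x * sqrt x = inverse (sqrt x)" if "x > 0" for x :: real
    using that by (simp add: field_simps flip: power2_eq_square)
  then show ?thesis
    using pos by (auto simp: diag_map_mult[OF L(1)] intro!: diag_map_cong_diag[OF L(1)])
qed

lemma diag_mult_inv_sqrt:
  "L * diag_map (\<lambda>x. inverse (sqrt x)) L = diag_map sqrt L"
proof -
  have id: "diag_map (\<lambda>x. x) L = L"
    by (rule diag_map_eq_self[OF L]) auto
  have "x * inverse (sqrt x) = sqrt x" if "x > 0" for x :: real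
    using that by (simp add: field_simps flip: power2_eq_square)
  then have "diag_map (\<lambda>x. x) L * diag_map (\<lambda>x. inverse (sqrt x)) L = diag_map sqrt L"
    using pos by (auto simp: diag_map_mult[OF L(1)] intro!: diag_map_cong_diag[OF L(1)])
  then show ?thesis
    by (simp add: id)
qed

lemma diag_inv_sqrt_square:
  "diag_map (\<lambda>x. inverse (sqrt x)) L * diag_map (\<lambda>x. inverse (sqrt x)) L = diag_map inverse L"
  using pos
  by (auto simp: diag_map_mult[OF L(1)] less_imp_le simp flip: inverse_mult_distrib
      intro!: diag_map_cong_diag[OF L(1)])

end

section \<open>Rank\<close>

text \<open>A left inverse makes \<open>W\<close> injective, so no nontrivial combination of its
  columns vanishes. Independence is a property of the set of columns, hence repeated columns have to
  be excluded separately.\<close>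

lemma (in vec_space) rank_left_invertible:
  assumes W: "W \<in> carrier_mat n r" and G: "G \<in> carrier_mat r n" and GW: "G * W = 1\<^sub>m r"
  shows "rank W = r"
proof -
  have "distinct (cols W)"
    unfolding distinct_conv_nth
  proof (intro allI impI notI)
    fix i j assume ij: "i < length (cols W)" "j < length (cols W)" "i \<noteq> j" "cols W ! i = cols W ! j"
    with W have ij': "i < r" "j < r" and "col W i = col W j" by auto
    \<comment> \<open>Multiplying two equal columns by \<open>G\<close> would identify two different
      unit vectors.\<close>
    then have "col (G * W) i = col (G * W) j"
      by (simp only: col_mult2[OF G W])
    then have "unit_vec r i = (unit_vec r j :: 'a vec)"
      using ij' by (simp add: GW)
    then show False
      using ij' ij(3) by (metis index_unit_vec(1) zero_neq_one)
  qed
  moreover have "lin_indpt (set (cols W))"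
  proof
    assume "lin_dep (set (cols W))"
    then obtain v where v: "v \<in> carrier_vec r" "v \<noteq> 0\<^sub>v r" "W *\<^sub>v v = 0\<^sub>v n"
      using lin_depE[OF W _ calculation] by blast
    have "v = (G * W) *\<^sub>v v"
      using v by (simp add: GW)
    also have "\<dots> = G *\<^sub>v 0\<^sub>v n"
      using v G W by (simp add: assoc_mult_mat_vec[of _ r n _ r])
    also have "\<dots> = 0\<^sub>v r"
      using G by auto
    finally show False
      using v by simp
  qed
  ultimately show ?thesis
    using lin_indpt_full_rank W by blast
qed

text \<open>Each of the two factorizations gives one inclusion between the column spaces.\<close>

lemma (in vec_space) rank_eq_if_factors_through:
  assumes X: "X \<in> carrier_mat n k" and W: "W \<in> carrier_mat n r"
    and R: "R \<in> carrier_mat r k" and E: "E \<in> carrier_mat k r"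
    and XW: "X = W * R" and WX: "W = X * E"
  shows "rank X = rank W"
proof -
  have "col_space X = col_space W"
  proof (intro equalityI subsetI)
    fix y assume "y \<in> col_space X"
    then obtain x where x: "x \<in> carrier_vec k" "y = X *\<^sub>v x" "y \<in> carrier_vec n"
      using X by (auto simp: col_space_eq)
    then have "y = W *\<^sub>v (R *\<^sub>v x)"
      using W R by (simp add: XW assoc_mult_mat_vec[of _ n r _ k])
    then show "y \<in> col_space W"
      using x W R by (auto simp: col_space_eq)
  next
    fix y assume "y \<in> col_space W"
    then obtain x where x: "x \<in> carrier_vec r" "y = W *\<^sub>v x" "y \<in> carrier_vec n"
      using W by (auto simp: col_space_eq)
    then have "y = X *\<^sub>v (E *\<^sub>v x)"
      using X E by (subst (asm) WX) (simp add: assoc_mult_mat_vec[of _ n k _ r])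
    then show "y \<in> col_space X"
      using x X E by (auto simp: col_space_eq)
  qed
  then show ?thesis
    by (simp add: rank_def col_space_def)
qed

text \<open>\<open>X\<close> has the same column space as \<open>U\<close>, and \<open>U\<close> has
  the left inverse \<open>transpose_mat U\<close>.\<close>

lemma rank_thin_svd:
  assumes "is_thin_svd m n r X U L V"
  shows "vec_space.rank m X = r"
proof -
  interpret vec_space "TYPE(real)" m .
  note svd = assms[unfolded is_thin_svd_def]
  have X: "X \<in> carrier_mat m n" and U: "U \<in> carrier_mat m r" "transpose_mat U * U = 1\<^sub>m r"
    and V: "V \<in> carrier_mat n r" "transpose_mat V * V = 1\<^sub>m r"
    and L: "L \<in> carrier_mat r r" "diagonal_mat L" "\<And>i. i < r \<Longrightarrow> L $$ (i,i) > 0"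
    and X_eq: "X = U * L * transpose_mat V"
    using svd by auto
  have "rank X = rank U"
  proof (rule rank_eq_if_factors_through[OF X U(1)])
    show "L * transpose_mat V \<in> carrier_mat r n" "V * diag_map inverse L \<in> carrier_mat n r"
      using L V by auto
    show "X = U * (L * transpose_mat V)"
      using U V L by (simp add: X_eq mult_mat_assoc_dim)
    \<comment> \<open>In \<open>U * L * V^T * V * L^(-1)\<close> the orthonormal columns of
      \<open>V\<close> cancel first, then \<open>L\<close> against its inverse.\<close>
    show "U = X * (V * diag_map inverse L)"
      using U(1) V L
      by (simp add: X_eq mult_mat_assoc_dim inverse_mult_cancel_left[OF V(2)]
          diag_mult_inverse[OF L])
  qed
  also have "\<dots> = r"
    using U by (intro rank_left_invertible[of _ _ "transpose_mat U"]) auto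
  finally show ?thesis .
qed

section \<open>Singular value decomposition of an outer product\<close>

text \<open>\<open>is_svd\<close> admits zero singular values; invertibility of \<open>D\<close>
  rules them out. The matrix \<open>V^T * E * U\<close> is a right inverse of \<open>L\<close>,
  which is impossible if \<open>L\<close> has a zero row.\<close>

lemma svd_singular_value_pos:
  assumes "is_svd n D U L V" and E: "E \<in> carrier_mat n n" "D * E = 1\<^sub>m n" and i: "i < n"
  shows "L $$ (i, i) > 0"
proof -
  have U: "U \<in> carrier_mat n n" "transpose_mat U * U = 1\<^sub>m n"
    and V: "V \<in> carrier_mat n n" "transpose_mat V * V = 1\<^sub>m n"
    and L: "L \<in> carrier_mat n n" "diagonal_mat L" "L $$ (i, i) \<ge> 0"
    and D: "D = U * L * transpose_mat V"
    using assms(1) i by (auto simp: is_svd_def real_orthogonal_def)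
  define Y where "Y = transpose_mat V * (E * U)"
  have Y: "Y \<in> carrier_mat n n"
    using V E U by (auto simp: Y_def)
  have "L * Y = transpose_mat U * (D * (E * U))"
    using U V L E by (simp add: D Y_def mult_mat_assoc_dim inverse_mult_cancel_left[OF U(2)])
  also have "\<dots> = 1\<^sub>m n"
    using U V L E(1) by (subst inverse_mult_cancel_left[OF E(2)]) (auto simp: D)
  finally have "(L * Y) $$ (i, i) = 1"
    using i by simp
  moreover have "(L * Y) $$ (i, i) = 0" if "L $$ (i, i) = 0"
  proof -
    have "L $$ (i, k) = 0" if "k < n" for k
      using that \<open>L $$ (i, i) = 0\<close> L i unfolding diagonal_mat_def by (cases "k = i") auto
    then show ?thesis
      using L Y i by (auto simp: scalar_prod_def intro!: sum.neutral)
  qed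
  ultimately show ?thesis
    using L(3) by fastforce
qed

text \<open>The eigenvalue \<open>S $$ (i, i)\<close> is the squared norm of column \<open>i\<close>
  of \<open>Z * Q\<close>. That column is nonzero because \<open>Z * Q\<close> inherits a left
  inverse from \<open>Z\<close>.\<close>

lemma gram_eigenvalue_pos:
  assumes Z: "Z \<in> carrier_mat m s" and G: "G \<in> carrier_mat s m" "G * Z = 1\<^sub>m s"
    and eig: "is_orth_diag s (transpose_mat Z * Z) Q S" and i: "i < s"
  shows "S $$ (i, i) > 0"
proof -
  have Q: "Q \<in> carrier_mat s s" "transpose_mat Q * Q = 1\<^sub>m s"
    and S: "S \<in> carrier_mat s s" "transpose_mat Z * Z = Q * S * transpose_mat Q"
    using eig by (auto simp: is_orth_diag_def real_orthogonal_def)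
  define W where "W = Z * Q"
  have W: "W \<in> carrier_mat m s"
    using Z Q by (simp add: W_def)
  have "transpose_mat W * W = transpose_mat Q * ((transpose_mat Z * Z) * Q)"
    using Z Q by (simp add: W_def transpose_mult_dim mult_mat_assoc_dim)
  also have "\<dots> = S"
    using Q S(1) by (simp add: S(2) mult_mat_assoc_dim inverse_mult_cancel_left[OF Q(2)] Q(2))
  finally have "S $$ (i, i) = (transpose_mat W * W) $$ (i, i)"
    by simp
  also have "\<dots> = (\<Sum>k = 0..<m. (W $$ (k, i))\<^sup>2)"
    using W i by (auto simp: scalar_prod_def power2_eq_square)
  finally have S_ii: "S $$ (i, i) = (\<Sum>k = 0..<m. (W $$ (k, i))\<^sup>2)" .
  define P where "P = transpose_mat Q * G"
  have P: "P \<in> carrier_mat s m"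
    using Q G by (simp add: P_def)
  have PW: "P * W = 1\<^sub>m s"
    using Z Q G by (simp add: P_def W_def mult_mat_assoc_dim inverse_mult_cancel_left[OF G(2)])
  have "(\<Sum>k = 0..<m. P $$ (i, k) * W $$ (k, i)) = (P * W) $$ (i, i)"
    using W P i by (simp add: scalar_prod_def)
  then have "(\<Sum>k = 0..<m. P $$ (i, k) * W $$ (k, i)) = 1"
    using i by (simp add: PW)
  \<comment> \<open>If column \<open>i\<close> of \<open>W\<close> were zero, the sum would be 0
    instead of 1.\<close>
  then obtain k where "k < m" "W $$ (k, i) \<noteq> 0"
    by (metis (no_types, lifting) atLeastLessThan_iff mult_zero_right sum.neutral zero_neq_one)
  then show ?thesis
    unfolding S_ii by (intro sum_pos2[of _ k]) auto
qed

text \<open>The eigenvectors turn the Gram matrix into \<open>S\<close>, and \<open>S^(-1/2)\<close>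
  on both sides turns \<open>S\<close> into the identity. The trailing factor \<open>R\<close> is
  there so that the result applies directly to \<open>Uo\<close> and \<open>Ho\<close>, with
  \<open>R\<close> being \<open>UD\<close> or \<open>HD\<close>.\<close>

lemma gram_normalized:
  assumes Z: "Z \<in> carrier_mat m s"
    and eig: "is_orth_diag s (transpose_mat Z * Z) Q S" and pos: "\<And>i. i < s \<Longrightarrow> S $$ (i, i) > 0"
    and R: "R \<in> carrier_mat s s" "transpose_mat R * R = 1\<^sub>m s"
  shows "transpose_mat (Z * Q * diag_map (\<lambda>x. inverse (sqrt x)) S * R)
    * (Z * Q * diag_map (\<lambda>x. inverse (sqrt x)) S * R) = 1\<^sub>m s" (is "transpose_mat ?W * ?W = _")
proof -
  define T where "T = diag_map (\<lambda>x. inverse (sqrt x)) S"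
  have Q: "Q \<in> carrier_mat s s" "transpose_mat Q * Q = 1\<^sub>m s"
    and S: "S \<in> carrier_mat s s" "diagonal_mat S"
    and ZZ: "transpose_mat Z * Z = Q * S * transpose_mat Q"
    using eig by (auto simp: is_orth_diag_def real_orthogonal_def)
  have T: "T \<in> carrier_mat s s" "transpose_mat T = T"
    using S by (auto simp: T_def transpose_diag_map)
  have STT: "T * (S * T) = 1\<^sub>m s"
    using diag_mult_inv_sqrt[OF S pos] diag_sqrt_mult_inv_sqrt(2)[OF S pos] by (simp add: T_def)
  have "transpose_mat ?W * ?W = transpose_mat R * (T * (transpose_mat Q * ((transpose_mat Z * Z) * (Q * (T * R)))))"
    unfolding T_def[symmetric]
    using Z Q T R by (simp add: transpose_mult_dim mult_mat_assoc_dim)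
  also have "\<dots> = transpose_mat R * (T * (S * T) * R)"
    unfolding ZZ
    using Q T R S by (simp add: mult_mat_assoc_dim inverse_mult_cancel_left[OF Q(2)])
  also have "\<dots> = 1\<^sub>m s"
    using R by (simp add: STT)
  finally show ?thesis .
qed

text \<open>Write \<open>QU = ZU * FU * SU^(-1/2)\<close> and \<open>QH\<close> likewise. Then
  \<open>ZU = QU * SU^(1/2) * FU^T\<close>, so \<open>ZU * ZH^T = QU * D * QH^T\<close>, and a
  decomposition of the small matrix \<open>D\<close> lifts to one of the product.\<close>

lemma thin_svd_outer_product:
  assumes ZU: "ZU \<in> carrier_mat m s" and GU: "GU \<in> carrier_mat s m" "GU * ZU = 1\<^sub>m s"
    and ZH: "ZH \<in> carrier_mat n s" and GH: "GH \<in> carrier_mat s n" "GH * ZH = 1\<^sub>m s"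
    and eigU: "is_orth_diag s (transpose_mat ZU * ZU) FU SU"
    and eigH: "is_orth_diag s (transpose_mat ZH * ZH) FH SH"
    and svd: "is_svd s (diag_map sqrt SU * transpose_mat FU * FH * diag_map sqrt SH) UD LD HD"
  shows "is_thin_svd m n s (ZU * transpose_mat ZH)
    (ZU * FU * diag_map (\<lambda>x. inverse (sqrt x)) SU * UD) LD
    (ZH * FH * diag_map (\<lambda>x. inverse (sqrt x)) SH * HD)"
    (is "is_thin_svd _ _ _ _ ?Uo _ ?Ho")
proof -
  have posU: "\<And>i. i < s \<Longrightarrow> SU $$ (i, i) > 0"
    by (rule gram_eigenvalue_pos[OF ZU GU eigU])
  have posH: "\<And>i. i < s \<Longrightarrow> SH $$ (i, i) > 0"
    by (rule gram_eigenvalue_pos[OF ZH GH eigH])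
  have FU: "FU \<in> carrier_mat s s" "transpose_mat FU * FU = 1\<^sub>m s" "FU * transpose_mat FU = 1\<^sub>m s"
    and SU: "SU \<in> carrier_mat s s" "diagonal_mat SU"
    using eigU by (auto simp: is_orth_diag_def real_orthogonal_def)
  have FH: "FH \<in> carrier_mat s s" "transpose_mat FH * FH = 1\<^sub>m s" "FH * transpose_mat FH = 1\<^sub>m s"
    and SH: "SH \<in> carrier_mat s s" "diagonal_mat SH"
    using eigH by (auto simp: is_orth_diag_def real_orthogonal_def)
  define TU where "TU = diag_map (\<lambda>x. inverse (sqrt x)) SU"
  define TH where "TH = diag_map (\<lambda>x. inverse (sqrt x)) SH"
  define RU where "RU = diag_map sqrt SU"
  define RH where "RH = diag_map sqrt SH"
  have T: "TU \<in> carrier_mat s s" "TH \<in> carrier_mat s s" "RU \<in> carrier_mat s s" "RH \<in> carrier_mat s s"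
    using SU SH by (auto simp: TU_def TH_def RU_def RH_def)
  have TH_sym: "transpose_mat TH = TH"
    using SH by (simp add: TH_def transpose_diag_map)
  have RT: "RU * TU = 1\<^sub>m s" "TU * RU = 1\<^sub>m s" "RH * TH = 1\<^sub>m s"
    unfolding TU_def RU_def TH_def RH_def
    by (rule diag_sqrt_mult_inv_sqrt[OF SU posU] diag_sqrt_mult_inv_sqrt[OF SH posH], assumption)+
  define D where "D = RU * transpose_mat FU * FH * RH"
  have D: "D \<in> carrier_mat s s"
    unfolding D_def using T FU(1) FH(1) by (intro mult_carrier_mat) auto
  have svd': "is_svd s D UD LD HD"
    using svd by (simp add: D_def RU_def RH_def)
  have UD: "UD \<in> carrier_mat s s" "transpose_mat UD * UD = 1\<^sub>m s"
    and HD: "HD \<in> carrier_mat s s" "transpose_mat HD * HD = 1\<^sub>m s"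
    and LD: "LD \<in> carrier_mat s s" "diagonal_mat LD"
    and D_eq: "D = UD * LD * transpose_mat HD"
    using svd' by (auto simp: is_svd_def real_orthogonal_def)
  have posD: "LD $$ (i, i) > 0" if "i < s" for i
  proof (rule svd_singular_value_pos[OF svd' _ _ that])
    \<comment> \<open>The witness is the product of the inverses of the four factors of
      \<open>D\<close>, in reverse order.\<close>
    show "TH * (transpose_mat FH * (FU * TU)) \<in> carrier_mat s s"
      using T FU FH by auto
    show "D * (TH * (transpose_mat FH * (FU * TU))) = 1\<^sub>m s"
      using T FU(1) FH(1)
      by (simp add: D_def mult_mat_assoc_dim inverse_mult_cancel_left[OF RT(3)]
          inverse_mult_cancel_left[OF FH(3)] inverse_mult_cancel_left[OF FU(2)] RT(1))
  qed
  have "?Uo * LD * transpose_mat ?Ho =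
      ZU * (FU * (TU * ((UD * LD * transpose_mat HD) * (TH * (transpose_mat FH * transpose_mat ZH)))))"
    unfolding TU_def[symmetric] TH_def[symmetric]
    using ZU ZH FU(1) FH(1) T UD(1) HD(1) LD
    by (simp add: transpose_mult_dim mult_mat_assoc_dim TH_sym)
  \<comment> \<open>Folding the bracket back into \<open>D\<close> leaves four adjacent pairs that
    cancel: \<open>RH * TH\<close>, \<open>FH * FH^T\<close>, \<open>TU * RU\<close> and
    \<open>FU * FU^T\<close>.\<close>
  also have "\<dots> = ZU * transpose_mat ZH"
    unfolding D_eq[symmetric]
    using ZU ZH FU(1) FH(1) T
    by (simp add: D_def mult_mat_assoc_dim inverse_mult_cancel_left[OF RT(3)]
        inverse_mult_cancel_left[OF RT(2)]
        inverse_mult_cancel_left[OF FH(3)] inverse_mult_cancel_left[OF FU(3)])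
  finally have prod: "?Uo * LD * transpose_mat ?Ho = ZU * transpose_mat ZH" .
  have "?Uo \<in> carrier_mat m s" "?Ho \<in> carrier_mat n s" "ZU * transpose_mat ZH \<in> carrier_mat m n"
    using ZU ZH FU(1) FH(1) SU(1) SH(1) UD(1) HD(1)
    by (auto intro!: mult_carrier_mat[where n = s] simp del: assoc_mult_mat)
  then show ?thesis
    unfolding is_thin_svd_def
    by (intro conjI allI impI prod LD posD gram_normalized[OF ZU eigU posU UD]
        gram_normalized[OF ZH eigH posH HD])
qed

section \<open>Factorization of the Nystrom approximation\<close>

lemma transpose_diagonal_mat:
  "L \<in> carrier_mat n n \<Longrightarrow> diagonal_mat L \<Longrightarrow> transpose_mat L = L"
  by (intro eq_matI) (auto simp: diagonal_mat_def, metis)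

text \<open>Transposition swaps the roles of \<open>U\<close> and \<open>H\<close>. The facts about
  the left factor therefore yield those about the right factor, with \<open>B^T\<close> in place of
  \<open>F\<close>.\<close>

lemma svd_transpose:
  "is_svd n A U L V \<Longrightarrow> is_svd n (transpose_mat A) V L U"
  by (auto simp: is_svd_def real_orthogonal_def transpose_mult_dim mult_mat_assoc_dim
      transpose_diagonal_mat)

context
  fixes A U L H :: "real mat" and s :: nat
  assumes svd: "is_svd s A U L H" and pos: "\<And>i. i < s \<Longrightarrow> L $$ (i, i) > 0"
begin

private lemma U: "U \<in> carrier_mat s s" "transpose_mat U * U = 1\<^sub>m s" "U * transpose_mat U = 1\<^sub>m s"
  and H: "H \<in> carrier_mat s s" "transpose_mat H * H = 1\<^sub>m s" "H * transpose_mat H = 1\<^sub>m s"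
  and L: "L \<in> carrier_mat s s" "diagonal_mat L"
  and A_eq: "A = U * L * transpose_mat H"
  using svd by (auto simp: is_svd_def real_orthogonal_def)

private lemma A: "A \<in> carrier_mat s s"
  using U H L by (simp add: A_eq)

text \<open>\<open>mat_inverse\<close> returns an option, so it is first shown to be
  \<open>Some Y\<close>; then \<open>Y\<close> equals the explicit inverse \<open>X\<close> by
  uniqueness.\<close>

lemma svd_mat_inverse: "the (mat_inverse A) = H * diag_map inverse L * transpose_mat U"
proof -
  define X where "X = H * diag_map inverse L * transpose_mat U"
  have X: "X \<in> carrier_mat s s"
    unfolding X_def using U H L by (intro mult_carrier_mat) auto
  have AX: "A * X = 1\<^sub>m s"
    using U H L(1)
    by (simp add: A_eq X_def mult_mat_assoc_dim inverse_mult_cancel_left[OF H(2)]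
        inverse_mult_cancel_left[OF diag_mult_inverse[OF L pos]])
  have XA: "X * A = 1\<^sub>m s"
    by (rule mat_mult_left_right_inverse[OF A X AX])
  have "A \<in> Units (ring_mat TYPE(real) s ())"
    using A X AX XA by (auto simp: Units_def ring_mat_def)
  then obtain Y where Y: "mat_inverse A = Some Y"
    using mat_inverse(1)[OF A] by (metis not_None_eq)
  then have "Y \<in> carrier_mat s s" "A * Y = 1\<^sub>m s"
    using mat_inverse(2)[OF A] by auto
  \<comment> \<open>Both sides are \<open>X * (A * Y)\<close>, evaluated once with
    \<open>A * Y = 1\<close> and once with \<open>X * A = 1\<close>.\<close>
  then have "X * 1\<^sub>m s = Y"
    using X A inverse_mult_cancel_left[OF XA, of Y] by auto
  then show ?thesis
    using right_mult_one_mat[OF X] Y by (simp add: X_def)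
qed

text \<open>Both blocks share the right factor \<open>H * L^(-1/2)\<close>: in the upper one
  \<open>A * H = U * L\<close>, in the lower one \<open>L^(-1) * L^(1/2) = L^(-1/2)\<close>.\<close>

lemma scaled_left_vectors:
  assumes F: "F \<in> carrier_mat k s"
  shows "(U @\<^sub>r F * H * diag_map inverse L) * diag_map sqrt L
    = (A @\<^sub>r F) * (H * diag_map (\<lambda>x. inverse (sqrt x)) L)"
proof -
  have "A * (H * diag_map (\<lambda>x. inverse (sqrt x)) L) = U * diag_map sqrt L"
    using U(1) H(1) L
    by (simp add: A_eq mult_mat_assoc_dim inverse_mult_cancel_left[OF H(2)]
        diag_mult_inv_sqrt[OF L pos])
  moreover have "F * H * diag_map inverse L * diag_map sqrt L
      = F * (H * diag_map (\<lambda>x. inverse (sqrt x)) L)"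
    using F H(1) L(1)
    by (simp add: mult_mat_assoc_dim diag_inverse_mult_sqrt[OF L pos])
  moreover have "F * H * diag_map inverse L \<in> carrier_mat k s"
    using F H L by (intro mult_carrier_mat) auto
  ultimately show ?thesis
    using F U H L A
    by (subst (1 2) append_rows_mult[where k = s and l = k and s = s and t = s]) auto
qed

text \<open>The upper block \<open>U * L^(1/2)\<close> has the inverse
  \<open>L^(-1/2) * U^T\<close>, which is then padded with zero columns.\<close>

lemma scaled_left_vectors_left_inverse:
  assumes F: "F \<in> carrier_mat k s"
  shows "\<exists>G \<in> carrier_mat s (s + k).
    G * ((U @\<^sub>r F * H * diag_map inverse L) * diag_map sqrt L) = 1\<^sub>m s"
proof -
  define W where "W = F * H * diag_map inverse L * diag_map sqrt L"
  have FHL: "F * H * diag_map inverse L \<in> carrier_mat k s"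
    using F H L by (intro mult_carrier_mat) auto
  have W: "W \<in> carrier_mat k s"
    unfolding W_def using L by (intro mult_carrier_mat[OF FHL]) auto
  have "(diag_map (\<lambda>x. inverse (sqrt x)) L * transpose_mat U) * (U * diag_map sqrt L) = 1\<^sub>m s"
    using U L
    by (simp add: mult_mat_assoc_dim inverse_mult_cancel_left[OF U(2)]
        diag_sqrt_mult_inv_sqrt(2)[OF L pos])
  then have "\<exists>G \<in> carrier_mat s (s + k). G * (U * diag_map sqrt L @\<^sub>r W) = 1\<^sub>m s"
    using U L W
    by (intro append_rows_left_inverse[of "diag_map (\<lambda>x. inverse (sqrt x)) L * transpose_mat U"]) auto
  moreover have "(U @\<^sub>r F * H * diag_map inverse L) * diag_map sqrt L = U * diag_map sqrt L @\<^sub>r W"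
    unfolding W_def using U FHL L by (intro append_rows_mult) auto
  ultimately show ?thesis
    by simp
qed

end

text \<open>Between the outer blocks stands \<open>H * L^(-1/2) * L^(-1/2) * U^T\<close>, which is
  the inverse of \<open>A\<close>.\<close>

lemma nystrom_eq_outer_product:
  assumes svd: "is_svd s A U L H" and pos: "\<And>i. i < s \<Longrightarrow> L $$ (i, i) > 0"
    and F: "F \<in> carrier_mat k s" and B: "B \<in> carrier_mat s l"
  shows "nystrom A B F = ((U @\<^sub>r F * H * diag_map inverse L) * diag_map sqrt L) *
    transpose_mat ((H @\<^sub>r transpose_mat B * U * diag_map inverse L) * diag_map sqrt L)"
proof -
  note svd' = svd_transpose[OF svd]
  have U: "U \<in> carrier_mat s s" and H: "H \<in> carrier_mat s s"
    and L: "L \<in> carrier_mat s s" "diagonal_mat L" and A_eq: "A = U * L * transpose_mat H"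
    using svd by (auto simp: is_svd_def real_orthogonal_def)
  have A: "A \<in> carrier_mat s s"
    using U H L by (simp add: A_eq)
  have B': "transpose_mat B \<in> carrier_mat l s"
    using B by simp
  define T where "T = diag_map (\<lambda>x. inverse (sqrt x)) L"
  have T: "T \<in> carrier_mat s s" "transpose_mat T = T" "T * T = diag_map inverse L"
    using L by (auto simp: T_def transpose_diag_map diag_inv_sqrt_square[OF L pos])
  have AB: "transpose_mat (transpose_mat A @\<^sub>r transpose_mat B) = A @\<^sub>c B"
    using A B by (subst transpose_append_rows[of _ s s _ l]) auto
  have "((A @\<^sub>r F) * (H * T)) * transpose_mat ((transpose_mat A @\<^sub>r transpose_mat B) * (U * T))
      = (A @\<^sub>r F) * (H * ((T * T) * (transpose_mat U * (A @\<^sub>c B))))"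
    using A B F U H T(1) by (simp add: transpose_mult_dim mult_mat_assoc_dim AB T(2))
  also have "\<dots> = nystrom A B F"
    using A B F U H L(1)
    by (simp add: nystrom_def svd_mat_inverse[OF svd pos] T(3) mult_mat_assoc_dim)
  finally show ?thesis
    using scaled_left_vectors[OF svd pos F] scaled_left_vectors[OF svd' pos B'] by (simp add: T_def)
qed

section \<open>Operation count\<close>

text \<open>The bound concerns every run, whichever decompositions are chosen. It holds vacuously if
  there is no run, so existence of runs is treated separately.\<close>

definition cost_bounded :: "'a costed \<Rightarrow> nat \<Rightarrow> bool" where
  "cost_bounded p N \<longleftrightarrow> (\<forall>x k. p x k \<longrightarrow> k \<le> N)"

text \<open>The continuation has to be bounded only at values that \<open>p\<close> can return. The
  rules below use this to pass on the dimensions of each intermediate matrix.\<close>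

lemma cost_bounded_bind:
  assumes "\<And>x k. p x k \<Longrightarrow> k \<le> i \<and> cost_bounded (f x) j"
  shows "cost_bounded (costed_bind p f) (i + j)"
  using assms unfolding cost_bounded_def costed_bind_def by (auto intro!: add_mono)

lemma cost_bounded_mul:
  assumes "X \<in> carrier_mat a b" "Y \<in> carrier_mat b d" "mul_cost a b d \<le> i"
    and "\<And>Z. Z \<in> carrier_mat a d \<Longrightarrow> cost_bounded (f Z) j"
  shows "cost_bounded (costed_bind (mul_op mul_cost X Y) f) (i + j)"
  using assms by (intro cost_bounded_bind) (auto simp: mul_op_def)

lemma cost_bounded_svd:
  assumes "X \<in> carrier_mat s s" "svd_cost s \<le> i"
    and "\<And>U L V. U \<in> carrier_mat s s \<Longrightarrow> L \<in> carrier_mat s s \<Longrightarrow> V \<in> carrier_mat s s \<Longrightarrow>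
      cost_bounded (f U L V) j"
  shows "cost_bounded (costed_bind (svd_op svd_cost X) (\<lambda>(U, L, V). f U L V)) (i + j)"
  using assms by (intro cost_bounded_bind) (auto simp: svd_op_def is_svd_def real_orthogonal_def)

lemma cost_bounded_eig:
  assumes "X \<in> carrier_mat s s" "eig_cost s \<le> i"
    and "\<And>Q S. Q \<in> carrier_mat s s \<Longrightarrow> S \<in> carrier_mat s s \<Longrightarrow> cost_bounded (f Q S) j"
  shows "cost_bounded (costed_bind (eig_op eig_cost X) (\<lambda>(Q, S). f Q S)) (i + j)"
  using assms by (intro cost_bounded_bind) (auto simp: eig_op_def is_orth_diag_def real_orthogonal_def)

lemma cost_bounded_diag:
  assumes "L \<in> carrier_mat s s" "s \<le> i"
    and "\<And>R. R \<in> carrier_mat s s \<Longrightarrow> cost_bounded (f R) j"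
  shows "cost_bounded (costed_bind (diag_sqrt_op L) f) (i + j)"
    and "cost_bounded (costed_bind (diag_inv_op L) f) (i + j)"
  using assms by (intro cost_bounded_bind; auto simp: diag_sqrt_op_def diag_inv_op_def)+

lemma cost_bounded_return: "cost_bounded (costed_return x) 0"
  by (simp add: cost_bounded_def costed_return_def)

text \<open>The procedure performs 27 charged operations, and each costs at most
  \<open>c * (s^2 * (m + n))\<close>.\<close>

lemma nystrom_svd_cost_bounded:
  assumes A: "A \<in> carrier_mat s s" and B: "B \<in> carrier_mat s (n - s)" and F: "F \<in> carrier_mat (m - s) s"
    and s: "1 \<le> s" "s \<le> m" "s \<le> n"
    and svd_cost: "\<And>k. svd_cost k \<le> c * k ^ 3" and eig_cost: "\<And>k. eig_cost k \<le> c * k ^ 3"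
    and mul_cost: "\<And>a b d. mul_cost a b d \<le> c * (a * b * d)" and c: "1 \<le> c"
  shows "cost_bounded (nystrom_svd svd_cost eig_cost mul_cost A B F) (27 * c * (s\<^sup>2 * (m + n)))"
proof -
  define t where "t = c * (s\<^sup>2 * (m + n))"
  have le_t: "c * (s\<^sup>2 * k) \<le> t" if "k \<le> m + n" for k
    using that unfolding t_def by (intro mult_left_mono) auto
  have mul_le: "mul_cost k s s \<le> t" "mul_cost s k s \<le> t" if "k \<le> m + n" for k
    using le_t[OF that] mul_cost[of k s s] mul_cost[of s k s]
    by (simp_all add: power2_eq_square algebra_simps)
  have mul: "mul_cost s s s \<le> t" "mul_cost m s s \<le> t" "mul_cost n s s \<le> t"
    "mul_cost (m - s) s s \<le> t" "mul_cost (n - s) s s \<le> t" "mul_cost s m s \<le> t" "mul_cost s n s \<le> t"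
    using s by (auto intro!: mul_le)
  have decomp_le: "svd_cost s \<le> t" "eig_cost s \<le> t"
    using le_t[of s] svd_cost[of s] eig_cost[of s] s
    by (simp_all add: power2_eq_square power3_eq_cube algebra_simps)
  \<comment> \<open>Operations on diagonal matrices cost \<open>s\<close>, with no factor
    \<open>c\<close>; here \<open>1 <= c\<close> and \<open>1 <= s\<close> enter.\<close>
  have "s * 1 \<le> (c * s) * (s * (m + n))"
    using c s by (intro mult_mono) auto
  then have s_le: "s \<le> t"
    by (simp add: t_def power2_eq_square algebra_simps)
  have rows: "X @\<^sub>r Y \<in> carrier_mat m s" if "X \<in> carrier_mat s s" "Y \<in> carrier_mat (m - s) s" for X Y :: "real mat"
    using carrier_append_rows[OF that] s by simp
  have cols: "X @\<^sub>r Y \<in> carrier_mat n s" if "X \<in> carrier_mat s s" "Y \<in> carrier_mat (n - s) s" for X Y :: "real mat"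
    using carrier_append_rows[OF that] s by simp
  \<comment> \<open>The sum is nested like the binds of the procedure, with one \<open>t\<close> per
    operation and 0 for the final return, so that each rule matches the form
    \<open>i + j\<close>.\<close>
  have "cost_bounded (nystrom_svd svd_cost eig_cost mul_cost A B F)
    (t+(t+(t+(t+(t+(t+(t+(t+(t+(t+(t+(t+(t+(t+(t+(t+(t+(t+(t+(t+(t+(t+(t+(t+(t+(t+(t+0)))))))))))))))))))))))))))" (is "cost_bounded _ ?N")
    unfolding nystrom_svd_def
    by (insert A B F,
        (rule cost_bounded_svd[where s = s] cost_bounded_eig[where s = s]
            cost_bounded_diag[where s = s] cost_bounded_mul cost_bounded_return decomp_le s_le mul
          | assumption
          | (rule transpose_carrier_mat[THEN iffD2], assumption)
          | (rule rows, assumption, assumption)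
          | (rule cols, assumption, assumption))+)
  moreover have "?N = 27 * t"
    by linarith
  ultimately show ?thesis
    by (simp only: t_def mult.assoc)
qed

section \<open>Runs of the procedure\<close>

text \<open>These rules follow only the result of a run; its cost stays existentially quantified,
  since it is bounded by \<open>cost_bounded\<close>.\<close>

lemma run_mul:
  "dim_col X = dim_row Y \<Longrightarrow> \<exists>k. f (X * Y) y k \<Longrightarrow> \<exists>k. costed_bind (mul_op mul_cost X Y) f y k"
  by (auto simp: costed_bind_def mul_op_def)

lemma run_svd:
  "is_svd (dim_row X) X U L V \<Longrightarrow> \<exists>k. f (U, L, V) y k \<Longrightarrow>
    \<exists>k. costed_bind (svd_op svd_cost X) f y k"
  by (fastforce simp: costed_bind_def svd_op_def)

lemma run_eig:
  "is_orth_diag (dim_row X) X Q S \<Longrightarrow> \<exists>k. f (Q, S) y k \<Longrightarrow>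
    \<exists>k. costed_bind (eig_op eig_cost X) f y k"
  by (fastforce simp: costed_bind_def eig_op_def)

lemma run_diag:
  "\<exists>k. f (diag_map sqrt L) y k \<Longrightarrow> \<exists>k. costed_bind (diag_sqrt_op L) f y k"
  "\<exists>k. f (diag_map inverse L) y k \<Longrightarrow> \<exists>k. costed_bind (diag_inv_op L) f y k"
  by (auto simp: costed_bind_def diag_sqrt_op_def diag_inv_op_def)

lemma run_return: "x = y \<Longrightarrow> \<exists>k. costed_return x y k"
  by (simp add: costed_return_def)

text \<open>The given decompositions resolve the nondeterministic choices. What remains is to check
  that the dimensions match, as \<open>mul_op\<close> has no run on incompatible factors.\<close>

lemma nystrom_svd_run:
  assumes A: "A \<in> carrier_mat s s" and B: "B \<in> carrier_mat s (n - s)" and F: "F \<in> carrier_mat (m - s) s"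
    and s: "s \<le> m" "s \<le> n"
    and svd: "is_svd s A U L H"
    and ZU: "ZU = (U @\<^sub>r F * H * diag_map inverse L) * diag_map sqrt L"
    and ZH: "ZH = (H @\<^sub>r transpose_mat B * U * diag_map inverse L) * diag_map sqrt L"
    and eigU: "is_orth_diag s (transpose_mat ZU * ZU) FU SU"
    and eigH: "is_orth_diag s (transpose_mat ZH * ZH) FH SH"
    and svdD: "is_svd s (diag_map sqrt SU * transpose_mat FU * FH * diag_map sqrt SH) UD LD HD"
  shows "\<exists>k. nystrom_svd svd_cost eig_cost mul_cost A B F
    (ZU * FU * diag_map (\<lambda>x. inverse (sqrt x)) SU * UD, LD,
     ZH * FH * diag_map (\<lambda>x. inverse (sqrt x)) SH * HD) k"
proof -
  have "U \<in> carrier_mat s s" "L \<in> carrier_mat s s" "H \<in> carrier_mat s s"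
    using svd by (auto simp: is_svd_def real_orthogonal_def)
  moreover have "FU \<in> carrier_mat s s" "SU \<in> carrier_mat s s" "FH \<in> carrier_mat s s" "SH \<in> carrier_mat s s"
    using eigU eigH by (auto simp: is_orth_diag_def real_orthogonal_def)
  moreover have "UD \<in> carrier_mat s s" "HD \<in> carrier_mat s s"
    using svdD by (auto simp: is_svd_def real_orthogonal_def)
  ultimately have dims:
    "dim_row A = s" "dim_col A = s" "dim_row B = s" "dim_col B = n - s" "dim_row F = m - s" "dim_col F = s"
    "dim_row U = s" "dim_col U = s" "dim_row L = s" "dim_col L = s" "dim_row H = s" "dim_col H = s"
    "dim_row FU = s" "dim_col FU = s" "dim_row SU = s" "dim_col SU = s"
    "dim_row FH = s" "dim_col FH = s" "dim_row SH = s" "dim_col SH = s"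
    "dim_row UD = s" "dim_col UD = s" "dim_row HD = s" "dim_col HD = s"
    using A B F by auto
  note dim_simps = dims append_rows_dims diag_map_dims index_mult_mat index_transpose_mat
  show ?thesis
    unfolding nystrom_svd_def ZU ZH
    apply (rule run_svd[where U = U and L = L and V = H])
     apply (simp only: dim_simps svd)
    apply (simp only: prod.case)
    apply (rule run_diag run_mul, (simp only: dim_simps)?)+
    apply (rule run_eig[where Q = FU and S = SU])
     apply (simp only: dim_simps eigU[unfolded ZU])
    apply (simp only: prod.case)
    apply (rule run_eig[where Q = FH and S = SH])
     apply (simp only: dim_simps eigH[unfolded ZH])
    apply (simp only: prod.case)
    apply (rule run_diag run_mul, (simp only: dim_simps)?)+
    apply (rule run_svd[where U = UD and L = LD and V = HD])
     apply (simp only: dim_simps svdD)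
    apply (simp only: prod.case)
    apply (rule run_diag run_mul, (simp only: dim_simps)?)+
    apply (rule run_return)
    \<comment> \<open>The procedure obtains the power \<open>-1/2\<close> in two operations, a
      square root followed by an inverse; here they merge into one map.\<close>
    apply (simp only: diag_map_diag_map)
    done
qed

theorem mainTheorem1:
  fixes svd_cost eig_cost :: "nat \<Rightarrow> nat" and mul_cost :: "nat \<Rightarrow> nat \<Rightarrow> nat \<Rightarrow> nat"
  assumes "\<exists>c. \<forall>k. svd_cost k \<le> c * k ^ 3"
    and "\<exists>c. \<forall>k. eig_cost k \<le> c * k ^ 3"
    and "\<exists>c. \<forall>a b d. mul_cost a b d \<le> c * (a * b * d)"
  shows "\<exists>K. \<forall>(m::nat) (n::nat) (s::nat) (M::real mat) A B F C U \<Lambda> H FU \<Sigma>U FH \<Sigma>H UD \<Lambda>D HD.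
    1 \<le> s \<longrightarrow> s \<le> min m n \<longrightarrow>
    M \<in> carrier_mat m n \<longrightarrow>
    A \<in> carrier_mat s s \<longrightarrow> B \<in> carrier_mat s (n - s) \<longrightarrow>
    F \<in> carrier_mat (m - s) s \<longrightarrow> C \<in> carrier_mat (m - s) (n - s) \<longrightarrow>
    M = four_block_mat A B F C \<longrightarrow>
    invertible_mat A \<longrightarrow>
    is_svd s A U \<Lambda> H \<longrightarrow> (\<forall>i<s. \<Lambda> $$ (i,i) > 0) \<longrightarrow>
    (let Mhat = nystrom A B F;
         Uhat = U @\<^sub>r (F * H * diag_map inverse \<Lambda>);
         Hhat = H @\<^sub>r (transpose_mat B * U * diag_map inverse \<Lambda>);
         ZU = Uhat * diag_map sqrt \<Lambda>;
         ZH = Hhat * diag_map sqrt \<Lambda>;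
         D = diag_map sqrt \<Sigma>U * transpose_mat FU * FH * diag_map sqrt \<Sigma>H;
         Uo = ZU * FU * diag_map (\<lambda>x. inverse (sqrt x)) \<Sigma>U * UD;
         Ho = ZH * FH * diag_map (\<lambda>x. inverse (sqrt x)) \<Sigma>H * HD
     in
       is_orth_diag s (transpose_mat ZU * ZU) FU \<Sigma>U \<longrightarrow>
       is_orth_diag s (transpose_mat ZH * ZH) FH \<Sigma>H \<longrightarrow>
       is_svd s D UD \<Lambda>D HD \<longrightarrow>
         transpose_mat Uo * Uo = 1\<^sub>m s \<and>
         transpose_mat Ho * Ho = 1\<^sub>m s \<and>
         Uo * \<Lambda>D * transpose_mat Ho = Mhat \<and>
         vec_space.rank m Mhat = s \<and>
         is_thin_svd m n s Mhat Uo \<Lambda>D Ho \<and>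
         (\<exists>k. nystrom_svd svd_cost eig_cost mul_cost A B F (Uo, \<Lambda>D, Ho) k) \<and>
         (\<forall>R k. nystrom_svd svd_cost eig_cost mul_cost A B F R k \<longrightarrow> k \<le> K * (s\<^sup>2 * (m + n))))"
proof -
  obtain c1 c2 c3 where costs: "\<And>k. svd_cost k \<le> c1 * k ^ 3" "\<And>k. eig_cost k \<le> c2 * k ^ 3"
    "\<And>a b d. mul_cost a b d \<le> c3 * (a * b * d)"
    using assms by blast
  \<comment> \<open>One constant serves all three cost functions; the summand 1 ensures
    \<open>1 <= c\<close>.\<close>
  define c where "c = c1 + c2 + c3 + 1"
  have "svd_cost k \<le> c * k ^ 3" "eig_cost k \<le> c * k ^ 3" "mul_cost a b d \<le> c * (a * b * d)" for k a b d
    using costs(1)[of k] costs(2)[of k] costs(3)[of a b d] by (simp_all add: c_def distrib_right)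
  note cost = nystrom_svd_cost_bounded[where c = c, OF _ _ _ _ _ _ this, unfolded cost_bounded_def]
  show ?thesis
    unfolding Let_def
  proof (intro exI[of _ "27 * c"] allI impI, goal_cases)
    case (1 m n s M A B F C U L H FU SU FH SH UD LD HD)
    note A = 1(4) and B = 1(5) and F = 1(6) and svd = 1(10) and eigU = 1(12) and eigH = 1(13) and svdD = 1(14)
    have s: "s \<le> m" "s \<le> n" using 1(2) by auto
    have pos: "\<And>i. i < s \<Longrightarrow> L $$ (i, i) > 0"
      using 1(11) by blast
    have B': "transpose_mat B \<in> carrier_mat (n - s) s"
      using B by simp
    define ZU where "ZU = (U @\<^sub>r F * H * diag_map inverse L) * diag_map sqrt L"
    define ZH where "ZH = (H @\<^sub>r transpose_mat B * U * diag_map inverse L) * diag_map sqrt L"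
    note Z = ZU_def[symmetric] ZH_def[symmetric]
    have UHL: "U \<in> carrier_mat s s" "L \<in> carrier_mat s s" "H \<in> carrier_mat s s"
      using svd by (auto simp: is_svd_def real_orthogonal_def)
    then have Z_carrier: "ZU \<in> carrier_mat m s" "ZH \<in> carrier_mat n s"
      using F B s by (auto simp: ZU_def ZH_def intro!: carrier_matI)
    \<comment> \<open>The left inverse has \<open>s + (m - s)\<close> columns, which is
      \<open>m\<close> because \<open>s <= m\<close>.\<close>
    obtain GU where GU: "GU \<in> carrier_mat s m" "GU * ZU = 1\<^sub>m s"
      using scaled_left_vectors_left_inverse[OF svd pos F] s by (auto simp: Z)
    obtain GH where GH: "GH \<in> carrier_mat s n" "GH * ZH = 1\<^sub>m s"
      using scaled_left_vectors_left_inverse[OF svd_transpose[OF svd] pos B'] s by (auto simp: Z)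
    have nys: "nystrom A B F = ZU * transpose_mat ZH"
      using nystrom_eq_outer_product[OF svd pos F B] by (simp add: Z)
    have thin: "is_thin_svd m n s (nystrom A B F)
        (ZU * FU * diag_map (\<lambda>x. inverse (sqrt x)) SU * UD) LD
        (ZH * FH * diag_map (\<lambda>x. inverse (sqrt x)) SH * HD)"
      unfolding nys
      by (rule thin_svd_outer_product[OF Z_carrier(1) GU Z_carrier(2) GH eigU[unfolded Z] eigH[unfolded Z] svdD])
    note parts = thin[unfolded is_thin_svd_def]
    have run: "\<exists>k. nystrom_svd svd_cost eig_cost mul_cost A B F
        (ZU * FU * diag_map (\<lambda>x. inverse (sqrt x)) SU * UD, LD,
         ZH * FH * diag_map (\<lambda>x. inverse (sqrt x)) SH * HD) k"
      by (rule nystrom_svd_run[OF A B F s svd ZU_def ZH_def eigU[unfolded Z] eigH[unfolded Z] svdD])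
    have bound: "\<forall>R k. nystrom_svd svd_cost eig_cost mul_cost A B F R k \<longrightarrow> k \<le> 27 * c * (s\<^sup>2 * (m + n))"
      by (rule cost[OF A B F 1(1) s]) (simp add: c_def)
    show ?case
      unfolding Z
      using parts rank_thin_svd[OF thin] thin run bound by blast
  qed
qed

end
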